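(* Let $q\ge0$, $t\ge1$ be integers. As an endomorphism of the abelian group $K(\overline{W}(q,t))$, the shift map $\rho$ satisfies $$\rho^2-(1+q+t)\rho+q=0.$$
   Context: $W_k(q,t)$ is the directed multigraph with hub $v_0$ and rim vertices $v_1,\dots,v_k$ (clockwise, indices mod $k$), with $t$ edges each way between $v_0$ and each $v_i$, one edge $v_i\to v_{i-1}$ and $q$ edges $v_i\to v_{i+1}$. Its critical group $K(W_k(q,t))$ (dollar game with bank $v_0$) is the group of critical configurations $[c_1,\dots,c_k]$ under $C_1\oplus C_2=$ the unique critical configuration reachable by legal firings from $C_1+C_2$; it is isomorphic to $\mathbb{Z}^k/\overline{M}_k\mathbb{Z}^k$ where $\overline{M}_1=[t]$, $\overline{M}_2=\begin{pmatrix}1+q+t&-1-q\\-1-q&1+q+t\end{pmatrix}$, and for $k\ge3$ $\overline{M}_k$ has diagonal entries $1+q+t$, entries $(i,i+1\bmod k)=-q$, $(i,i-1\bmod k)=-1$, others $0$. For $k_1\mid k_2$ the map $w\mapsto ww\cdots w$ ($k_2/k_1$ copies) is an injective homomorphism $K(W_{k_1}(q,t))\to K(W_{k_2}(q,t))$; $K(\overline{W}(q,t))$ is the direct limit of the $K(W_k(q,t))$ along these maps, equivalently the group of bi-infinite periodic sequences whose period block is a critical configuration of some $W_k(q,t)$. The shift map $\rho$ shifts sequences left; on $K(W_k(q,t))$ it is $[c_1,\dots,c_k]\mapsto[c_2,\dots,c_k,c_1]$. Integer polynomials in $\rho$ are interpreted using the group operation. *)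

theory Defs
  imports "HOL-Algebra.Group"
begin

section \<open>The dollar game on a directed multigraph\<close>

text \<open>A directed multigraph is given by a vertex set \<open>V\<close> and a multiplicity function \<open>E\<close>:
  \<open>E u v\<close> is the number of edges from \<open>u\<close> to \<open>v\<close>. Loops are allowed and count towards
  the out-degree. The bank is the vertex \<open>b\<close>.\<close>

definition outdeg :: "'v set \<Rightarrow> ('v \<Rightarrow> 'v \<Rightarrow> nat) \<Rightarrow> 'v \<Rightarrow> nat" where
  "outdeg V E u = (\<Sum>v\<in>V. E u v)"

text \<open>A configuration records the dollars on the vertices other than the bank (the bank holds the
  negative of the total). Values off \<open>V - {b}\<close> are normalised to \<open>0\<close>, so that configurations
  are determined by their values on \<open>V - {b}\<close>.\<close>

definition configs :: "'v set \<Rightarrow> 'v \<Rightarrow> ('v \<Rightarrow> int) set" where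
  "configs V b = {c. (\<forall>v\<in>V - {b}. 0 \<le> c v) \<and> (\<forall>v. v \<notin> V - {b} \<longrightarrow> c v = 0)}"

definition fire :: "'v set \<Rightarrow> ('v \<Rightarrow> 'v \<Rightarrow> nat) \<Rightarrow> 'v \<Rightarrow> 'v \<Rightarrow> ('v \<Rightarrow> int) \<Rightarrow> ('v \<Rightarrow> int)" where
  "fire V E b u c = (\<lambda>v. if v \<in> V - {b}
     then c v - (if v = u then int (outdeg V E u) else 0) + int (E u v) else 0)"

definition stable :: "'v set \<Rightarrow> ('v \<Rightarrow> 'v \<Rightarrow> nat) \<Rightarrow> 'v \<Rightarrow> ('v \<Rightarrow> int) \<Rightarrow> bool" where
  "stable V E b c \<longleftrightarrow> (\<forall>v\<in>V - {b}. c v < int (outdeg V E v))"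

text \<open>The bank may fire only when no other vertex can.\<close>

definition legal :: "'v set \<Rightarrow> ('v \<Rightarrow> 'v \<Rightarrow> nat) \<Rightarrow> 'v \<Rightarrow> 'v \<Rightarrow> ('v \<Rightarrow> int) \<Rightarrow> bool" where
  "legal V E b u c \<longleftrightarrow>
     u \<in> V \<and> (if u = b then stable V E b c else int (outdeg V E u) \<le> c u)"

definition legal_step ::
    "'v set \<Rightarrow> ('v \<Rightarrow> 'v \<Rightarrow> nat) \<Rightarrow> 'v \<Rightarrow> ('v \<Rightarrow> int) \<Rightarrow> ('v \<Rightarrow> int) \<Rightarrow> bool" where
  "legal_step V E b c c' \<longleftrightarrow> (\<exists>u. legal V E b u c \<and> c' = fire V E b u c)"

text \<open>Critical means stable and recurrent, i.e. some nonempty sequence of legal firings leads back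
  to the configuration.\<close>

definition critical :: "'v set \<Rightarrow> ('v \<Rightarrow> 'v \<Rightarrow> nat) \<Rightarrow> 'v \<Rightarrow> ('v \<Rightarrow> int) \<Rightarrow> bool" where
  "critical V E b c \<longleftrightarrow>
     c \<in> configs V b \<and> stable V E b c \<and> (legal_step V E b)\<^sup>+\<^sup>+ c c"

definition crit_sum ::
    "'v set \<Rightarrow> ('v \<Rightarrow> 'v \<Rightarrow> nat) \<Rightarrow> 'v \<Rightarrow> ('v \<Rightarrow> int) \<Rightarrow> ('v \<Rightarrow> int) \<Rightarrow> ('v \<Rightarrow> int)" where
  "crit_sum V E b c1 c2 =
     (THE c. critical V E b c \<and> (legal_step V E b)\<^sup>*\<^sup>* (\<lambda>v. c1 v + c2 v) c)"

text \<open>A set with a binary operation as a monoid record, the unit being the neutral element.\<close>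

definition mk_monoid :: "'a set \<Rightarrow> ('a \<Rightarrow> 'a \<Rightarrow> 'a) \<Rightarrow> 'a monoid" where
  "mk_monoid A f =
     \<lparr>carrier = A, monoid.mult = f, one = (THE e. e \<in> A \<and> (\<forall>x\<in>A. f e x = x \<and> f x e = x))\<rparr>"

definition critical_group :: "'v set \<Rightarrow> ('v \<Rightarrow> 'v \<Rightarrow> nat) \<Rightarrow> 'v \<Rightarrow> ('v \<Rightarrow> int) monoid" where
  "critical_group V E b = mk_monoid {c. critical V E b c} (crit_sum V E b)"


section \<open>The wheel graphs\<close>

text \<open>The hub is \<open>0\<close> and the rim vertices are \<open>1, \<dots>, k\<close> in clockwise order. For \<open>k = 2\<close> the
  two kinds of rim edges are parallel; for \<open>k = 1\<close> they are \<open>1 + q\<close> loops.\<close>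

definition rim_next :: "nat \<Rightarrow> nat \<Rightarrow> nat" where
  "rim_next k i = (if i = k then 1 else i + 1)"

definition rim_prev :: "nat \<Rightarrow> nat \<Rightarrow> nat" where
  "rim_prev k i = (if i = 1 then k else i - 1)"

definition wheel_edges :: "nat \<Rightarrow> nat \<Rightarrow> nat \<Rightarrow> nat \<Rightarrow> nat \<Rightarrow> nat" where
  "wheel_edges k q t u v =
     (if u = 0 \<and> v \<in> {1..k} \<or> u \<in> {1..k} \<and> v = 0 then t
      else if u \<in> {1..k} \<and> v \<in> {1..k}
      then (if v = rim_prev k u then 1 else 0) + (if v = rim_next k u then q else 0)
      else 0)"

definition wheel_group :: "nat \<Rightarrow> nat \<Rightarrow> nat \<Rightarrow> (nat \<Rightarrow> int) monoid" where
  "wheel_group k q t = critical_group {0..k} (wheel_edges k q t) 0"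


section \<open>The direct limit, as a group of bi-infinite periodic sequences\<close>

text \<open>The sequence \<open>\<dots>www\<dots>\<close> for \<open>w = [c 1, \<dots>, c k]\<close>, with \<open>c 1\<close> at position \<open>1\<close>.\<close>

definition unroll :: "nat \<Rightarrow> (nat \<Rightarrow> int) \<Rightarrow> (int \<Rightarrow> int)" where
  "unroll k c = (\<lambda>j. c (nat ((j - 1) mod int k) + 1))"

text \<open>Two sequences are added in \<open>K(W\<^sub>k(q,t))\<close> for any common period \<open>k\<close>; the result
  does not depend on \<open>k\<close>.\<close>

definition limit_sum :: "nat \<Rightarrow> nat \<Rightarrow> (int \<Rightarrow> int) \<Rightarrow> (int \<Rightarrow> int) \<Rightarrow> (int \<Rightarrow> int)" where
  "limit_sum q t s1 s2 =
     (THE s. \<exists>k\<ge>1. \<exists>c1\<in>carrier (wheel_group k q t). \<exists>c2\<in>carrier (wheel_group k q t).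
        s1 = unroll k c1 \<and> s2 = unroll k c2 \<and> s = unroll k (c1 \<otimes>\<^bsub>wheel_group k q t\<^esub> c2))"

definition limit_group :: "nat \<Rightarrow> nat \<Rightarrow> (int \<Rightarrow> int) monoid" where
  "limit_group q t =
     mk_monoid {unroll k c | k c. 1 \<le> k \<and> c \<in> carrier (wheel_group k q t)} (limit_sum q t)"

definition shift :: "(int \<Rightarrow> int) \<Rightarrow> (int \<Rightarrow> int)" where
  "shift s = (\<lambda>j. s (j + 1))"

end

theory Submission
  imports Defs
begin

text \<open>Unroll configurations to bi-infinite sequences and call two sequences equivalent if they
  differ by \<open>D f\<close> for a bounded \<open>f\<close>, where \<open>D f = (1+q+t) f - \<rho> f - q \<rho>\<^sup>-\<^sup>1 f\<close> is what the
  sequence loses when each rim vertex \<open>j\<close> fires \<open>f j\<close> times; a firing of the bank adds \<open>t = D 1\<close>.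
  Hence legal firings stay within a class. A critical configuration contains no forbidden subconfiguration (Dhar's burning
  criterion), and a maximum principle for \<open>D\<close> shows that a class contains at most one stable
  sequence with this property. Since each rim firing loses \<open>t\<close> dollars to the bank, stabilisation
  terminates, so every class of periodic sequences contains a critical one. Thus the limit group is
  the group of periodic sequences modulo equivalence, and
  \<open>\<rho>\<^sup>2 s - (1+q+t) \<rho> s + q s = - D (\<rho> s)\<close> is equivalent to \<open>0\<close>.\<close>

section \<open>The Laplacian of the bi-infinite rim\<close>

text \<open>Vertex \<open>j\<close> gains one dollar when \<open>j + 1\<close> fires and
  \<open>q\<close> dollars when \<open>j - 1\<close> fires. On the line covering the rim, the loops
  for \<open>k = 1\<close> and the parallel edges for \<open>k = 2\<close> come out of the
  periodicity of \<open>f\<close>.\<close>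

definition rim_laplacian :: "nat \<Rightarrow> nat \<Rightarrow> (int \<Rightarrow> int) \<Rightarrow> int \<Rightarrow> int" where
  "rim_laplacian q t f j = int (1 + q + t) * f j - f (j + 1) - int q * f (j - 1)"

text \<open>Boundedness replaces periodicity, so that sequences of different periods are compared
  without choosing a common one.\<close>

definition bounded_seq :: "(int \<Rightarrow> int) \<Rightarrow> bool" where
  "bounded_seq f \<longleftrightarrow> (\<exists>B. \<forall>j. \<bar>f j\<bar> \<le> B)"

definition firing_equiv :: "nat \<Rightarrow> nat \<Rightarrow> (int \<Rightarrow> int) \<Rightarrow> (int \<Rightarrow> int) \<Rightarrow> bool" where
  "firing_equiv q t x y \<longleftrightarrow> (\<exists>f. bounded_seq f \<and> (\<forall>j. x j = y j + rim_laplacian q t f j))"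

lemma bounded_seq_const: "bounded_seq (\<lambda>_. a)"
  unfolding bounded_seq_def by blast

lemma bounded_seq_of_bool: "bounded_seq (\<lambda>j. of_bool (j \<in> U))"
  unfolding bounded_seq_def by (intro exI[of _ 1]) auto

lemma bounded_seq_add:
  assumes "bounded_seq f" "bounded_seq g"
  shows "bounded_seq (\<lambda>j. f j + g j)"
proof -
  obtain A B where AB: "\<forall>j. \<bar>f j\<bar> \<le> A" "\<forall>j. \<bar>g j\<bar> \<le> B"
    using assms unfolding bounded_seq_def by blast
  have "\<bar>f j + g j\<bar> \<le> A + B" for j
    using AB(1)[rule_format, of j] AB(2)[rule_format, of j] by linarith
  then show ?thesis
    unfolding bounded_seq_def by blast
qed

lemma bounded_seq_uminus: "bounded_seq f \<Longrightarrow> bounded_seq (\<lambda>j. - f j)"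
  unfolding bounded_seq_def by simp

lemma bounded_seq_diff: "bounded_seq f \<Longrightarrow> bounded_seq g \<Longrightarrow> bounded_seq (\<lambda>j. f j - g j)"
  using bounded_seq_add[OF _ bounded_seq_uminus, of f g] by simp

lemma bounded_seq_shift: "bounded_seq f \<Longrightarrow> bounded_seq (shift f)"
  unfolding bounded_seq_def shift_def by blast

text \<open>A bounded integer sequence takes finitely many values, so its supremum is attained
  although the index set is infinite.\<close>

lemma bounded_seq_attains_max:
  assumes "bounded_seq f"
  obtains v where "\<And>j. f j \<le> f v"
proof -
  obtain B where B: "\<forall>j. \<bar>f j\<bar> \<le> B"
    using assms unfolding bounded_seq_def by blast
  have "range f \<subseteq> {-B..B}"
    using B by (auto simp: abs_le_iff minus_le_iff)
  then have fin: "finite (range f)"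
    by (rule finite_subset) simp
  then have "Max (range f) \<in> range f"
    by (intro Max_in) auto
  then obtain v where "Max (range f) = f v"
    by blast
  then have "f j \<le> f v" for j
    using fin by (metis Max_ge rangeI)
  then show ?thesis by (rule that)
qed

section \<open>Linearity of the rim Laplacian and the maximum principle\<close>

lemma rim_laplacian_add:
  "rim_laplacian q t (\<lambda>j. f j + g j) j = rim_laplacian q t f j + rim_laplacian q t g j"
  unfolding rim_laplacian_def by (simp add: algebra_simps)

lemma rim_laplacian_uminus: "rim_laplacian q t (\<lambda>j. - f j) j = - rim_laplacian q t f j"
  unfolding rim_laplacian_def by (simp add: algebra_simps)

lemma rim_laplacian_diff:
  "rim_laplacian q t (\<lambda>j. f j - g j) j = rim_laplacian q t f j - rim_laplacian q t g j"
  unfolding rim_laplacian_def by (simp add: algebra_simps)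

lemma rim_laplacian_const: "rim_laplacian q t (\<lambda>_. a) j = int t * a"
  unfolding rim_laplacian_def by (simp add: algebra_simps)

text \<open>In this form both differences are nonnegative wherever \<open>f\<close> is
  maximal.\<close>

lemma rim_laplacian_excess:
  "rim_laplacian q t f v = int t * f v + (f v - f (v + 1)) + int q * (f v - f (v - 1))"
  unfolding rim_laplacian_def by (simp add: algebra_simps)

text \<open>At a maximum \<open>v\<close> the neighbour terms only help, so
  \<open>int t * f v\<close> is at most the Laplacian at \<open>v\<close>, hence at most 0.\<close>

lemma rim_laplacian_max_principle:
  assumes t: "1 \<le> t" and f: "bounded_seq f" and D: "\<And>j. rim_laplacian q t f j \<le> 0"
  shows "f j \<le> 0"
proof -
  obtain v where v: "\<And>j. f j \<le> f v"
    using bounded_seq_attains_max[OF f] by blast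
  have "int t * f v \<le> rim_laplacian q t f v"
    unfolding rim_laplacian_excess
    using v[of "v + 1"] mult_nonneg_nonneg[of "int q" "f v - f (v - 1)"] v[of "v - 1"] by linarith
  with D[of v] have "int t * f v \<le> 0" by linarith
  then have "f v \<le> 0" using t by (simp add: mult_le_0_iff)
  with v[of j] show ?thesis by linarith
qed

lemma rim_laplacian_injective:
  assumes "1 \<le> t" and f: "bounded_seq f" and D: "\<And>j. rim_laplacian q t f j = 0"
  shows "f j = 0"
  using rim_laplacian_max_principle[OF assms(1) f, of q j]
    rim_laplacian_max_principle[OF assms(1) bounded_seq_uminus[OF f], of q j]
  by (simp add: D rim_laplacian_uminus)

section \<open>Firing equivalence as a shift-invariant congruence\<close>

lemma firing_equivI: "bounded_seq f \<Longrightarrow> (\<And>j. x j = y j + rim_laplacian q t f j) \<Longrightarrow> firing_equiv q t x y"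
  unfolding firing_equiv_def by blast

lemma firing_equiv_refl: "firing_equiv q t x x"
  by (rule firing_equivI[OF bounded_seq_const[of 0]]) (simp add: rim_laplacian_const)

lemma firing_equiv_sym:
  assumes "firing_equiv q t x y"
  shows "firing_equiv q t y x"
proof -
  obtain f where "bounded_seq f" "\<And>j. x j = y j + rim_laplacian q t f j"
    using assms unfolding firing_equiv_def by blast
  then show ?thesis
    by (intro firing_equivI[of "\<lambda>j. - f j"]) (simp_all add: bounded_seq_uminus rim_laplacian_uminus)
qed

lemma firing_equiv_trans:
  assumes "firing_equiv q t x y" "firing_equiv q t y z"
  shows "firing_equiv q t x z"
proof -
  obtain f g where "bounded_seq f" "\<And>j. x j = y j + rim_laplacian q t f j"
    "bounded_seq g" "\<And>j. y j = z j + rim_laplacian q t g j"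
    using assms unfolding firing_equiv_def by blast
  then show ?thesis
    by (intro firing_equivI[of "\<lambda>j. f j + g j"])
      (auto simp: bounded_seq_add rim_laplacian_add)
qed

lemma firing_equiv_add:
  assumes "firing_equiv q t x y" "firing_equiv q t x' y'"
  shows "firing_equiv q t (\<lambda>j. x j + x' j) (\<lambda>j. y j + y' j)"
proof -
  obtain f g where "bounded_seq f" "\<And>j. x j = y j + rim_laplacian q t f j"
    "bounded_seq g" "\<And>j. x' j = y' j + rim_laplacian q t g j"
    using assms unfolding firing_equiv_def by blast
  then show ?thesis
    by (intro firing_equivI[of "\<lambda>j. f j + g j"])
      (auto simp: bounded_seq_add rim_laplacian_add)
qed

lemma firing_equiv_shift: "firing_equiv q t x y \<Longrightarrow> firing_equiv q t (shift x) (shift y)"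
proof -
  assume "firing_equiv q t x y"
  then obtain f where f: "bounded_seq f" "\<And>j. x j = y j + rim_laplacian q t f j"
    unfolding firing_equiv_def by blast
  show ?thesis
    by (rule firing_equivI[OF bounded_seq_shift[OF f(1)]])
      (simp add: f(2) shift_def rim_laplacian_def add_ac)
qed

lemma firing_equiv_add_const: "firing_equiv q t (\<lambda>j. x j + int t * a) x"
  by (rule firing_equivI[OF bounded_seq_const[of a]]) (simp add: rim_laplacian_const)

section \<open>Recurrent sequences\<close>

text \<open>The dollars \<open>v\<close> receives along rim edges when every vertex of
  \<open>S\<close> fires once.\<close>

definition inflow :: "nat \<Rightarrow> int set \<Rightarrow> int \<Rightarrow> int" where
  "inflow q S v = of_bool (v + 1 \<in> S) + int q * of_bool (v - 1 \<in> S)"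

text \<open>The second clause excludes forbidden subconfigurations. It ranges over arbitrary sets of
  integers, finite or not, so no period enters. The bound \<open>q + t\<close> is one below the
  out-degree.\<close>

definition recurrent_seq :: "nat \<Rightarrow> nat \<Rightarrow> (int \<Rightarrow> int) \<Rightarrow> bool" where
  "recurrent_seq q t s \<longleftrightarrow>
     (\<forall>j. 0 \<le> s j \<and> s j \<le> int (q + t)) \<and> (\<forall>S. S \<noteq> {} \<longrightarrow> (\<exists>v\<in>S. inflow q S v \<le> s v))"

lemma recurrent_seqD:
  assumes "recurrent_seq q t s"
  shows "0 \<le> s j" "s j \<le> int (q + t)" "S \<noteq> {} \<Longrightarrow> \<exists>v\<in>S. inflow q S v \<le> s v"
  using assms unfolding recurrent_seq_def by simp_all

lemma inflow_mono: "S \<subseteq> T \<Longrightarrow> inflow q S v \<le> inflow q T v"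
  unfolding inflow_def by (intro add_mono mult_left_mono) auto

lemma inflow_Un: "inflow q (S \<union> T) v \<le> inflow q S v + inflow q T v"
  unfolding inflow_def by (simp add: algebra_simps of_bool_def)

lemma rim_laplacian_of_bool:
  "rim_laplacian q t (\<lambda>j. of_bool (j \<in> U)) j = int (1 + q + t) * of_bool (j \<in> U) - inflow q U j"
  unfolding rim_laplacian_def inflow_def by simp

lemma recurrent_seq_shift:
  assumes "recurrent_seq q t s"
  shows "recurrent_seq q t (shift s)"
  unfolding recurrent_seq_def
proof (intro conjI allI impI)
  fix S :: "int set"
  assume "S \<noteq> {}"
  then have "(\<lambda>j. j + 1) ` S \<noteq> {}" by simp
  then obtain v where v: "v \<in> (\<lambda>j. j + 1) ` S" "inflow q ((\<lambda>j. j + 1) ` S) v \<le> s v"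
    using recurrent_seqD(3)[OF assms] by metis
  then obtain u where u: "u \<in> S" "v = u + 1" by blast
  have "x + 1 \<in> (\<lambda>j. j + 1) ` S \<longleftrightarrow> x \<in> S" for x :: int
    by auto
  from this[of "u + 1"] this[of "u - 1"] have "inflow q ((\<lambda>j. j + 1) ` S) v = inflow q S u"
    unfolding inflow_def u(2) by simp
  with v u show "\<exists>v\<in>S. inflow q S v \<le> shift s v"
    by (auto simp: shift_def)
qed (use recurrent_seqD(1,2)[OF assms] in \<open>simp_all add: shift_def\<close>)

text \<open>On the set \<open>S\<close> where \<open>f\<close> attains a positive maximum, \<open>D f\<close> is so large that \<open>S\<close> would be
  forbidden for \<open>y\<close>.\<close>

lemma recurrent_seq_firing_nonpos:
  assumes t: "1 \<le> t" and x: "recurrent_seq q t x" and y: "recurrent_seq q t y"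
    and f: "bounded_seq f" and xy: "\<And>j. x j = y j + rim_laplacian q t f j"
  shows "f j \<le> 0"
proof (rule ccontr)
  assume "\<not> f j \<le> 0"
  obtain w where w: "\<And>j. f j \<le> f w"
    using bounded_seq_attains_max[OF f] by blast
  have pos: "1 \<le> f w"
    using w[of j] \<open>\<not> f j \<le> 0\<close> by linarith
  define S where "S = {j. f j = f w}"
  have "w \<in> S" by (simp add: S_def)
  then obtain v where v: "v \<in> S" "inflow q S v \<le> y v"
    using recurrent_seqD(3)[OF y, of S] by blast
  have fv: "f v = f w" using v(1) by (simp add: S_def)
  have "of_bool (v + 1 \<notin> S) \<le> f v - f (v + 1)"
    using w[of "v + 1"] by (auto simp: S_def fv)
  moreover have "int q * of_bool (v - 1 \<notin> S) \<le> int q * (f v - f (v - 1))"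
    using w[of "v - 1"] by (intro mult_left_mono) (auto simp: S_def fv)
  moreover have "int t \<le> int t * f v"
    using pos t by (simp add: fv)
  ultimately have "int t + of_bool (v + 1 \<notin> S) + int q * of_bool (v - 1 \<notin> S)
      \<le> rim_laplacian q t f v"
    unfolding rim_laplacian_excess by linarith
  \<comment> \<open>Each neighbour of \<open>v\<close> is counted once: inside \<open>S\<close> it
    contributes to the inflow, outside \<open>S\<close> to a drop of \<open>f\<close> by at least 1.
    So \<open>x v\<close> reaches the full out-degree \<open>1 + q + t\<close>.\<close>
  moreover have "of_bool (v + 1 \<notin> S) + int q * of_bool (v - 1 \<notin> S) + inflow q S v = 1 + int q"
    unfolding inflow_def by auto
  ultimately have "int (q + t) < x v"
    using v(2) xy[of v] by simp
  then show False
    using recurrent_seqD(2)[OF x, of v] by linarith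
qed

text \<open>Exchanging \<open>x\<close> and \<open>y\<close> turns \<open>f\<close> into its
  negative, so the one-sided bound applied twice gives \<open>f = 0\<close>.\<close>

lemma recurrent_seq_unique:
  assumes t: "1 \<le> t" and x: "recurrent_seq q t x" and y: "recurrent_seq q t y"
    and "firing_equiv q t x y"
  shows "x = y"
proof
  fix j
  obtain f where f: "bounded_seq f" and xy: "\<And>j. x j = y j + rim_laplacian q t f j"
    using assms(4) unfolding firing_equiv_def by blast
  have "f j \<le> 0" for j
    using recurrent_seq_firing_nonpos[OF t x y f xy] .
  moreover have "- f j \<le> 0" for j
    using recurrent_seq_firing_nonpos[OF t y x bounded_seq_uminus[OF f]]
    by (simp add: xy rim_laplacian_uminus)
  ultimately have "f j = 0" for j
    by (metis antisym neg_le_0_iff_le)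
  then show "x j = y j"
    unfolding xy rim_laplacian_def by simp
qed

section \<open>Legal firings on the wheel as operations on sequences\<close>

abbreviation wheel_step :: "nat \<Rightarrow> nat \<Rightarrow> nat \<Rightarrow> (nat \<Rightarrow> int) \<Rightarrow> (nat \<Rightarrow> int) \<Rightarrow> bool" where
  "wheel_step k q t \<equiv> legal_step {0..k} (wheel_edges k q t) 0"

abbreviation wheel_stable :: "nat \<Rightarrow> nat \<Rightarrow> nat \<Rightarrow> (nat \<Rightarrow> int) \<Rightarrow> bool" where
  "wheel_stable k q t \<equiv> stable {0..k} (wheel_edges k q t) 0"

abbreviation wheel_critical :: "nat \<Rightarrow> nat \<Rightarrow> nat \<Rightarrow> (nat \<Rightarrow> int) \<Rightarrow> bool" where
  "wheel_critical k q t \<equiv> critical {0..k} (wheel_edges k q t) 0"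

section \<open>Firings in the coordinates of the finite wheel\<close>

lemma rim_vertices: "{0..k} - {0::nat} = {1..k}"
  by auto

lemma outdeg_wheel_split:
  assumes "u \<in> {1..k}"
  shows "outdeg {0..k} (wheel_edges k q t) u = t + (\<Sum>v\<in>{1..k}. wheel_edges k q t u v)"
proof -
  have "{0..k} = insert 0 {1..k}" by auto
  then show ?thesis
    using assms by (simp add: outdeg_def wheel_edges_def)
qed

text \<open>The two indicator sums are evaluated separately, so it does not matter that
  \<open>rim_prev\<close> and \<open>rim_next\<close> coincide for \<open>k = 1\<close> and
  \<open>k = 2\<close>.\<close>

lemma outdeg_wheel:
  assumes "u \<in> {1..k}"
  shows "outdeg {0..k} (wheel_edges k q t) u = 1 + q + t"
proof -
  have "rim_prev k u \<in> {1..k}" "rim_next k u \<in> {1..k}"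
    using assms by (auto simp: rim_prev_def rim_next_def)
  moreover have "(\<Sum>v\<in>{1..k}. wheel_edges k q t u v) =
      (\<Sum>v\<in>{1..k}. (if v = rim_prev k u then 1 else 0) + (if v = rim_next k u then q else 0))"
    using assms by (intro sum.cong) (auto simp: wheel_edges_def)
  ultimately have "(\<Sum>v\<in>{1..k}. wheel_edges k q t u v) = 1 + q"
    by (simp add: sum.distrib sum.delta)
  then show ?thesis
    using outdeg_wheel_split[OF assms] by simp
qed

lemma fire_bank:
  "v \<in> {1..k} \<Longrightarrow> fire {0..k} (wheel_edges k q t) 0 0 c v = c v + int t"
  by (simp add: fire_def wheel_edges_def)

lemma fire_rim:
  "u \<in> {1..k} \<Longrightarrow> v \<in> {1..k} \<Longrightarrow> fire {0..k} (wheel_edges k q t) 0 u c v =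
     c v - int (1 + q + t) * of_bool (v = u) + of_bool (v = rim_prev k u)
       + int q * of_bool (v = rim_next k u)"
  by (simp add: fire_def outdeg_wheel wheel_edges_def)

lemma legal_step_configs:
  assumes "c \<in> configs V b" "legal_step V E b c c'"
  shows "c' \<in> configs V b"
  using assms unfolding configs_def legal_step_def legal_def fire_def by (auto split: if_splits)

section \<open>Rim vertices as residue classes of integers\<close>

lemma rim_index:
  assumes "1 \<le> k"
  shows "nat ((j - 1) mod int k) + 1 \<in> {1..k}"
  using assms pos_mod_bound[of "int k" "j - 1"] pos_mod_sign[of "int k" "j - 1"]
  by (simp add: nat_less_iff Suc_le_eq)

text \<open>Trades the index inside \<open>unroll\<close> for a congruence, where neighbours are
  plainly \<open>j + 1\<close> and \<open>j - 1\<close>. The right side is reduced as well because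
  \<open>u = k\<close> represents the class of 0.\<close>

lemma rim_index_eq_iff:
  assumes "u \<in> {1..k}"
  shows "nat ((j - 1) mod int k) + 1 = u \<longleftrightarrow> j mod int k = int u mod int k"
proof -
  have *: "0 < int k" "int u - 1 = (int u - 1) mod int k" "0 \<le> (j - 1) mod int k"
    using assms by auto
  have "nat ((j - 1) mod int k) + 1 = u \<longleftrightarrow> (j - 1) mod int k = (int u - 1) mod int k"
    using *(2,3) by linarith
  also have "\<dots> \<longleftrightarrow> j mod int k = int u mod int k"
    by (simp add: mod_eq_dvd_iff)
  finally show ?thesis .
qed

lemma rim_prev_mod: "u \<in> {1..k} \<Longrightarrow> int (rim_prev k u) mod int k = (int u - 1) mod int k"
  by (auto simp: rim_prev_def of_nat_diff)

lemma rim_next_mod: "u \<in> {1..k} \<Longrightarrow> int (rim_next k u) mod int k = (int u + 1) mod int k"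
  by (auto simp: rim_next_def add.commute)

text \<open>A firing of \<open>u\<close> lifts to one simultaneous firing of all integers congruent
  to \<open>u\<close>. Position \<open>j\<close> precedes a lift of \<open>u\<close> iff
  \<open>j + 1\<close> is in \<open>U\<close>, which is where the edge to \<open>rim_prev\<close>
  shows up.\<close>

lemma unroll_fire_rim:
  assumes u: "u \<in> {1..k}"
  defines "U \<equiv> {j. j mod int k = int u mod int k}"
  shows "unroll k (fire {0..k} (wheel_edges k q t) 0 u c) j =
    unroll k c j - rim_laplacian q t (\<lambda>j. of_bool (j \<in> U)) j"
proof -
  have k: "1 \<le> k" using u by simp
  define i where "i = nat ((j - 1) mod int k) + 1"
  have i: "i \<in> {1..k}" unfolding i_def by (rule rim_index[OF k])
  have nbrs: "rim_prev k u \<in> {1..k}" "rim_next k u \<in> {1..k}"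
    using u by (auto simp: rim_prev_def rim_next_def)
  have "i = u \<longleftrightarrow> j \<in> U"
    unfolding i_def rim_index_eq_iff[OF u] U_def by simp
  moreover have "i = rim_prev k u \<longleftrightarrow> j + 1 \<in> U"
    unfolding i_def rim_index_eq_iff[OF nbrs(1)] U_def rim_prev_mod[OF u]
    by (simp add: mod_eq_dvd_iff algebra_simps)
  moreover have "i = rim_next k u \<longleftrightarrow> j - 1 \<in> U"
    unfolding i_def rim_index_eq_iff[OF nbrs(2)] U_def rim_next_mod[OF u]
    by (simp add: mod_eq_dvd_iff algebra_simps)
  ultimately show ?thesis
    unfolding unroll_def i_def[symmetric] fire_rim[OF u i] rim_laplacian_of_bool inflow_def
    by simp
qed

text \<open>Removes the wheel from the firing argument: what remains are sequences and sets
  \<open>U\<close> whose members can all afford to fire.\<close>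

lemma wheel_step_cases:
  assumes k: "1 \<le> k" and step: "wheel_step k q t c c'"
  obtains (bank) "\<And>j. unroll k c' j = unroll k c j + int t"
  | (rim) U where "U \<noteq> {}" "\<And>j. j \<in> U \<Longrightarrow> int (1 + q + t) \<le> unroll k c j"
      "\<And>j. unroll k c' j = unroll k c j - rim_laplacian q t (\<lambda>j. of_bool (j \<in> U)) j"
proof -
  obtain u where u: "legal {0..k} (wheel_edges k q t) 0 u c"
    and c': "c' = fire {0..k} (wheel_edges k q t) 0 u c"
    using step unfolding legal_step_def by blast
  show ?thesis
  proof (cases "u = 0")
    case True
    then have "unroll k c' j = unroll k c j + int t" for j
      unfolding c' unroll_def using fire_bank[OF rim_index[OF k]] by simp
    then show ?thesis by (rule bank)
  next
    case False
    then have uk: "u \<in> {1..k}" and le: "int (1 + q + t) \<le> c u"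
      using u outdeg_wheel[of u k q t] by (auto simp: legal_def)
    have "int (1 + q + t) \<le> unroll k c j" if "j \<in> {j. j mod int k = int u mod int k}" for j
      using that rim_index_eq_iff[OF uk, of j] le by (simp add: unroll_def)
    then show ?thesis
      by (intro rim[of "{j. j mod int k = int u mod int k}"]) (auto simp: c' unroll_fire_rim[OF uk])
  qed
qed

section \<open>Critical configurations unroll to recurrent sequences\<close>

text \<open>Starting from \<open>x\<close>, the bank has fired \<open>m\<close> times and the rim vertex \<open>j\<close> has fired \<open>f j\<close> times,
  with result \<open>y\<close>; no set of vertices that have all fired is forbidden for \<open>y\<close>.\<close>

definition firing_record ::
    "nat \<Rightarrow> nat \<Rightarrow> (int \<Rightarrow> int) \<Rightarrow> (int \<Rightarrow> int) \<Rightarrow> int \<Rightarrow> (int \<Rightarrow> int) \<Rightarrow> bool" where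
  "firing_record q t x y m f \<longleftrightarrow>
     bounded_seq f \<and> 0 \<le> m \<and> (\<forall>j. 0 \<le> f j) \<and>
     (\<forall>j. y j = x j + int t * m - rim_laplacian q t f j) \<and>
     (\<forall>S. S \<noteq> {} \<longrightarrow> (\<forall>j\<in>S. 0 < f j) \<longrightarrow> (\<exists>v\<in>S. inflow q S v \<le> y v))"

lemma firing_recordD:
  assumes "firing_record q t x y m f"
  shows "bounded_seq f" "0 \<le> m" "0 \<le> f j" "y j = x j + int t * m - rim_laplacian q t f j"
    "S \<noteq> {} \<Longrightarrow> (\<And>j. j \<in> S \<Longrightarrow> 0 < f j) \<Longrightarrow> \<exists>v\<in>S. inflow q S v \<le> y v"
  using assms unfolding firing_record_def by (simp, simp, simp, simp, blast)

lemma firing_record_init: "firing_record q t x x 0 (\<lambda>_. 0)"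
  unfolding firing_record_def by (auto simp: bounded_seq_const rim_laplacian_const)

lemma firing_record_bank:
  assumes "firing_record q t x y m f" and z: "\<And>j. z j = y j + int t"
  shows "firing_record q t x z (m + 1) f"
  unfolding firing_record_def
proof (intro conjI allI impI)
  fix S :: "int set"
  assume "S \<noteq> {}" "\<forall>j\<in>S. 0 < f j"
  then obtain v where "v \<in> S" "inflow q S v \<le> y v"
    using firing_recordD(5)[OF assms(1), of S] by blast
  then show "\<exists>v\<in>S. inflow q S v \<le> z v"
    by (intro bexI[of _ v]) (simp_all add: z)
qed (use firing_recordD(1-4)[OF assms(1)] in \<open>simp_all add: z algebra_simps\<close>)

text \<open>If all of \<open>S\<close> has just fired, each of its vertices could pay the out-degree
  beforehand and so keeps at least what \<open>U\<close> sent it. Otherwise \<open>S - U\<close> had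
  fired earlier and contains a good vertex \<open>v\<close>; firing \<open>U\<close> adds
  \<open>inflow q U v\<close>, which covers the part of the inflow coming from
  \<open>U\<close>.\<close>

lemma firing_record_rim:
  assumes rec: "firing_record q t x y m f"
    and U: "\<And>j. j \<in> U \<Longrightarrow> int (1 + q + t) \<le> y j"
    and z: "\<And>j. z j = y j - rim_laplacian q t (\<lambda>j. of_bool (j \<in> U)) j"
  shows "firing_record q t x z m (\<lambda>j. f j + of_bool (j \<in> U))"
  unfolding firing_record_def
proof (intro conjI allI impI)
  fix S :: "int set"
  assume S: "S \<noteq> {}" "\<forall>j\<in>S. 0 < f j + of_bool (j \<in> U)"
  show "\<exists>v\<in>S. inflow q S v \<le> z v"
  proof (cases "S \<subseteq> U")
    case True
    obtain v where "v \<in> S" using S(1) by blast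
    moreover have "inflow q S v \<le> z v"
      using U[of v] \<open>v \<in> S\<close> True inflow_mono[OF True, of q v]
      unfolding z rim_laplacian_of_bool by auto
    ultimately show ?thesis by blast
  next
    case False
    moreover have "0 < f j" if "j \<in> S - U" for j
      using S(2) that by (metis Diff_iff add.right_neutral of_bool_eq(1))
    ultimately obtain v where v: "v \<in> S - U" "inflow q (S - U) v \<le> y v"
      using firing_recordD(5)[OF rec, of "S - U"] by blast
    have "inflow q S v \<le> inflow q ((S - U) \<union> U) v"
      by (intro inflow_mono) auto
    also have "\<dots> \<le> inflow q (S - U) v + inflow q U v"
      by (rule inflow_Un)
    also have "\<dots> \<le> z v"
      using v unfolding z rim_laplacian_of_bool by simp
    finally show ?thesis using v(1) by blast
  qed
qed (use firing_recordD(1-4)[OF rec] in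
    \<open>simp_all add: z rim_laplacian_add bounded_seq_add bounded_seq_of_bool\<close>)

text \<open>The final disjunction remembers that something has fired, which later excludes the empty
  cycle.\<close>

lemma firing_record_step:
  assumes k: "1 \<le> k" and step: "wheel_step k q t c c'"
    and rec: "firing_record q t x (unroll k c) m f"
  shows "\<exists>m' f'. firing_record q t x (unroll k c') m' f' \<and> (m' \<noteq> 0 \<or> f' \<noteq> (\<lambda>_. 0))"
  using k step
proof (cases rule: wheel_step_cases)
  case bank
  have "m + 1 \<noteq> 0" using firing_recordD(2)[OF rec] by simp
  with firing_record_bank[OF rec bank] show ?thesis by (intro exI conjI disjI1)
next
  case (rim U)
  obtain u where "u \<in> U" using rim(1) by blast
  moreover have "0 \<le> f u" using firing_recordD(3)[OF rec] .
  ultimately have "f u + of_bool (u \<in> U) \<noteq> 0" by simp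
  then have "(\<lambda>j. f j + of_bool (j \<in> U)) \<noteq> (\<lambda>_. 0)" by meson
  with firing_record_rim[OF rec rim(2,3)] show ?thesis by (intro exI conjI disjI2)
qed

lemma firing_record_tranclp:
  assumes k: "1 \<le> k" and "(wheel_step k q t)\<^sup>+\<^sup>+ c d"
  shows "\<exists>m f. firing_record q t (unroll k c) (unroll k d) m f \<and> (m \<noteq> 0 \<or> f \<noteq> (\<lambda>_. 0))"
  using assms(2)
proof (induction rule: tranclp_induct)
  case (base d)
  show ?case by (rule firing_record_step[OF k base firing_record_init])
next
  case (step d e)
  then obtain m f where "firing_record q t (unroll k c) (unroll k d) m f" by blast
  from firing_record_step[OF k step.hyps(2) this] show ?case .
qed

lemma wheel_steps_firing_equiv:
  assumes k: "1 \<le> k" and "(wheel_step k q t)\<^sup>*\<^sup>* c d"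
  shows "firing_equiv q t (unroll k d) (unroll k c)"
proof (cases "c = d")
  case True
  then show ?thesis by (simp add: firing_equiv_refl)
next
  case False
  then have "(wheel_step k q t)\<^sup>+\<^sup>+ c d"
    using assms(2) by (metis rtranclpD)
  then obtain m f where rec: "firing_record q t (unroll k c) (unroll k d) m f"
    using firing_record_tranclp[OF k] by blast
  show ?thesis
  proof (rule firing_equivI)
    \<comment> \<open>The \<open>m\<close> firings of the bank add \<open>int t * m\<close>, the
      Laplacian of the constant \<open>m\<close>, so they combine with \<open>f\<close> into one
      witness.\<close>
    show "bounded_seq (\<lambda>j. m - f j)"
      using bounded_seq_diff[OF bounded_seq_const firing_recordD(1)[OF rec]] .
    show "unroll k d j = unroll k c j + rim_laplacian q t (\<lambda>j. m - f j) j" for j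
      using firing_recordD(4)[OF rec, of j] by (simp add: rim_laplacian_diff rim_laplacian_const)
  qed
qed

lemma critical_recurrent_seq:
  assumes k: "1 \<le> k" and t: "1 \<le> t" and crit: "wheel_critical k q t c"
  shows "recurrent_seq q t (unroll k c)"
proof -
  obtain m f where rec: "firing_record q t (unroll k c) (unroll k c) m f"
    and nontriv: "m \<noteq> 0 \<or> f \<noteq> (\<lambda>_. 0)"
    using crit firing_record_tranclp[OF k] unfolding critical_def by blast
  \<comment> \<open>\<open>D\<close> is injective on bounded sequences, so along a cycle every rim vertex fires as often as
    the bank.\<close>
  have fm: "f j = m" for j
  proof -
    have "f j - m = 0"
    proof (rule rim_laplacian_injective[OF t, where f = "\<lambda>j. f j - m"])
      show "bounded_seq (\<lambda>j. f j - m)"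
        using bounded_seq_diff[OF firing_recordD(1)[OF rec] bounded_seq_const] .
      show "rim_laplacian q t (\<lambda>j. f j - m) j = 0" for j
        using firing_recordD(4)[OF rec, of j] by (simp add: rim_laplacian_diff rim_laplacian_const)
    qed
    then show ?thesis by simp
  qed
  then have "f = (\<lambda>_. m)" by blast
  \<comment> \<open>A nonempty cycle cannot have \<open>m = 0\<close>, so every rim vertex has fired
    and the condition in \<open>firing_record\<close> covers all nonempty sets.\<close>
  with nontriv have "m \<noteq> 0" by auto
  then have "0 < f j" for j
    using firing_recordD(2)[OF rec] fm by (simp add: less_le)
  then have "\<exists>v\<in>S. inflow q S v \<le> unroll k c v" if "S \<noteq> {}" for S
    using firing_recordD(5)[OF rec that] by blast
  moreover have "0 \<le> unroll k c j \<and> unroll k c j \<le> int (q + t)" for j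
  proof -
    let ?i = "nat ((j - 1) mod int k) + 1"
    have i: "?i \<in> {1..k}" by (rule rim_index[OF k])
    have "0 \<le> c ?i"
      using crit i unfolding critical_def configs_def rim_vertices by blast
    moreover have "c ?i < int (1 + q + t)"
      using crit i unfolding critical_def stable_def rim_vertices
      by (simp only: flip: outdeg_wheel[OF i])
    ultimately show ?thesis by (simp add: unroll_def)
  qed
  ultimately show ?thesis
    unfolding recurrent_seq_def by blast
qed

section \<open>Existence of critical configurations\<close>

lemma sum_fire_rim:
  assumes u: "u \<in> {1..k}"
  shows "(\<Sum>v\<in>{1..k}. fire {0..k} (wheel_edges k q t) 0 u c v) = (\<Sum>v\<in>{1..k}. c v) - int t"
proof -
  have "(\<Sum>v\<in>{1..k}. fire {0..k} (wheel_edges k q t) 0 u c v) =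
      (\<Sum>v\<in>{1..k}. c v - (if v = u then int (outdeg {0..k} (wheel_edges k q t) u) else 0)
        + int (wheel_edges k q t u v))"
    by (intro sum.cong) (auto simp: fire_def)
  also have "\<dots> = (\<Sum>v\<in>{1..k}. c v) - int (outdeg {0..k} (wheel_edges k q t) u)
      + int (\<Sum>v\<in>{1..k}. wheel_edges k q t u v)"
    using u by (simp add: sum.distrib sum_subtractf sum.delta)
  finally show ?thesis
    using outdeg_wheel_split[OF u, of q t] by simp
qed

text \<open>Induction on the total on the rim: a rim firing sends \<open>t\<close> dollars to the
  bank, and legal firings keep every entry nonnegative.\<close>

lemma wheel_stabilises:
  assumes t: "1 \<le> t" and "c \<in> configs {0..k} 0"
  shows "\<exists>d. (wheel_step k q t)\<^sup>*\<^sup>* c d \<and> d \<in> configs {0..k} 0 \<and> wheel_stable k q t d"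
  using assms(2)
proof (induction "nat (\<Sum>v\<in>{1..k}. c v)" arbitrary: c rule: less_induct)
  case less
  show ?case
  proof (cases "wheel_stable k q t c")
    case True
    with less.prems show ?thesis by blast
  next
    case False
    then obtain u where u: "u \<in> {1..k}" "int (outdeg {0..k} (wheel_edges k q t) u) \<le> c u"
      unfolding stable_def rim_vertices by (auto simp: not_less)
    define d where "d = fire {0..k} (wheel_edges k q t) 0 u c"
    have step: "wheel_step k q t c d"
      unfolding legal_step_def legal_def d_def using u by (intro exI[of _ u]) auto
    have d: "d \<in> configs {0..k} 0"
      using legal_step_configs[OF less.prems step] .
    then have "0 \<le> (\<Sum>v\<in>{1..k}. d v)"
      unfolding configs_def rim_vertices by (intro sum_nonneg) blast
    moreover have "(\<Sum>v\<in>{1..k}. d v) = (\<Sum>v\<in>{1..k}. c v) - int t"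
      unfolding d_def by (rule sum_fire_rim[OF u(1)])
    ultimately have "nat (\<Sum>v\<in>{1..k}. d v) < nat (\<Sum>v\<in>{1..k}. c v)"
      using t by linarith
    from less.hyps[OF this d] step show ?thesis
      by (meson converse_rtranclp_into_rtranclp)
  qed
qed

text \<open>Finiteness rests on the convention that configurations vanish off the rim.\<close>

lemma finite_stable_configs: "finite {c. c \<in> configs {0..k} 0 \<and> wheel_stable k q t c}"
proof (rule finite_subset)
  show "{c. c \<in> configs {0..k} 0 \<and> wheel_stable k q t c} \<subseteq>
    {c. \<forall>v. (v \<in> {1..k} \<longrightarrow> c v \<in> {0..int (q + t)}) \<and> (v \<notin> {1..k} \<longrightarrow> c v = 0)}"
  proof (intro subsetI CollectI allI conjI impI)
    fix c v
    assume c: "c \<in> {c. c \<in> configs {0..k} 0 \<and> wheel_stable k q t c}"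
    show "c v \<in> {0..int (q + t)}" if v: "v \<in> {1..k}"
    proof -
      have "0 \<le> c v"
        using c v unfolding configs_def rim_vertices by blast
      moreover have "c v < int (1 + q + t)"
        using c v unfolding stable_def rim_vertices
        by (simp only: flip: outdeg_wheel[OF v]) blast
      ultimately show ?thesis by simp
    qed
    show "c v = 0" if "v \<notin> {1..k}"
      using c that unfolding configs_def rim_vertices by blast
  qed
  show "finite {c. \<forall>v. (v \<in> {1..k} \<longrightarrow> c v \<in> {0..int (q + t)}) \<and> (v \<notin> {1..k} \<longrightarrow> c v = 0)}"
    by (rule finite_set_of_finite_funs) auto
qed

text \<open>Pigeonhole on the iterates of a successor function. Using the transitive closure for
  each successor makes the cycle nonempty.\<close>

lemma finite_reaches_cycle:
  assumes fin: "finite P" and x: "x \<in> P" and next_ex: "\<And>x. x \<in> P \<Longrightarrow> \<exists>y\<in>P. R\<^sup>+\<^sup>+ x y"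
  shows "\<exists>y\<in>P. R\<^sup>*\<^sup>* x y \<and> R\<^sup>+\<^sup>+ y y"
proof -
  obtain g where g: "\<And>x. x \<in> P \<Longrightarrow> g x \<in> P \<and> R\<^sup>+\<^sup>+ x (g x)"
    using next_ex by metis
  have inP: "(g ^^ n) x \<in> P" for n
    by (induction n) (use x g in auto)
  have path: "R\<^sup>+\<^sup>+ ((g ^^ i) x) ((g ^^ j) x)" if "i < j" for i j
    using that
    by (induction j) (use g inP in \<open>auto simp: less_Suc_eq intro: tranclp_trans\<close>)
  have "\<not> inj (\<lambda>n. (g ^^ n) x)"
    using inP finite_subset[OF _ fin] by (metis finite_imageD image_subsetI infinite_UNIV_nat)
  then obtain i j where ij: "i < j" "(g ^^ i) x = (g ^^ j) x"
    by (metis linorder_injI)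
  have "R\<^sup>*\<^sup>* x ((g ^^ i) x)"
    using path[of 0 i] by (cases i) (auto simp: tranclp_into_rtranclp)
  moreover have "R\<^sup>+\<^sup>+ ((g ^^ i) x) ((g ^^ i) x)"
    using path[OF ij(1)] ij(2) by simp
  ultimately show ?thesis using inP by blast
qed

lemma wheel_reaches_critical:
  assumes t: "1 \<le> t" and c: "c \<in> configs {0..k} 0"
  shows "\<exists>d. wheel_critical k q t d \<and> (wheel_step k q t)\<^sup>*\<^sup>* c d"
proof -
  let ?P = "{c. c \<in> configs {0..k} 0 \<and> wheel_stable k q t c}"
  obtain d where d: "(wheel_step k q t)\<^sup>*\<^sup>* c d" "d \<in> ?P"
    using wheel_stabilises[OF t c] by blast
  have "\<exists>y\<in>?P. (wheel_step k q t)\<^sup>+\<^sup>+ x y" if x: "x \<in> ?P" for x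
  proof -
    \<comment> \<open>Stability is exactly what lets the bank fire. Stabilising again then gives a
      nonempty path from \<open>x\<close> to a stable configuration.\<close>
    have step: "wheel_step k q t x (fire {0..k} (wheel_edges k q t) 0 0 x)"
      using x unfolding legal_step_def legal_def by (intro exI[of _ 0]) auto
    have "fire {0..k} (wheel_edges k q t) 0 0 x \<in> configs {0..k} 0"
      using legal_step_configs[OF _ step] x by simp
    then obtain y where "(wheel_step k q t)\<^sup>*\<^sup>* (fire {0..k} (wheel_edges k q t) 0 0 x) y" "y \<in> ?P"
      using wheel_stabilises[OF t] by blast
    with step show ?thesis by (meson rtranclp_into_tranclp2)
  qed
  from finite_reaches_cycle[OF finite_stable_configs d(2) this] obtain y
    where "y \<in> ?P" "(wheel_step k q t)\<^sup>*\<^sup>* d y" "(wheel_step k q t)\<^sup>+\<^sup>+ y y"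
    by blast
  with d(1) show ?thesis
    unfolding critical_def by (auto intro: rtranclp_trans)
qed

section \<open>Periodic sequences\<close>

definition periodic_seq :: "nat \<Rightarrow> (int \<Rightarrow> int) \<Rightarrow> bool" where
  "periodic_seq k s \<longleftrightarrow> (\<forall>j. s (j + int k) = s j)"

lemma periodic_seq_add_multiple:
  assumes "periodic_seq k s"
  shows "s (j + int n * int k) = s j"
proof (induction n)
  case (Suc n)
  have "s (j + int (Suc n) * int k) = s ((j + int n * int k) + int k)"
    by (simp add: algebra_simps)
  also have "\<dots> = s j"
    using Suc assms unfolding periodic_seq_def by simp
  finally show ?case .
qed simp

lemma periodic_seq_mod:
  assumes s: "periodic_seq k s"
  shows "s (j mod int k) = s j"
proof (cases "0 \<le> j div int k")
  case True
  then have "j = j mod int k + int (nat (j div int k)) * int k"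
    by simp
  then show ?thesis
    using periodic_seq_add_multiple[OF s] by metis
next
  case False
  then have "j mod int k = j + int (nat (- (j div int k))) * int k"
    by (simp add: minus_div_mult_eq_mod [symmetric])
  then show ?thesis
    using periodic_seq_add_multiple[OF s] by metis
qed

lemma periodic_seq_mult:
  assumes "periodic_seq k s"
  shows "periodic_seq (k * n) s" "periodic_seq (n * k) s"
  using periodic_seq_add_multiple[OF assms, of _ n]
  unfolding periodic_seq_def by (simp_all add: mult.commute)

lemma periodic_seq_bounded:
  assumes k: "1 \<le> k" and s: "periodic_seq k s"
  shows "bounded_seq s"
proof -
  have "\<bar>s j\<bar> \<le> (\<Sum>i\<in>{0..<int k}. \<bar>s i\<bar>)" for j
  proof -
    have "j mod int k \<in> {0..<int k}" using k by simp
    then have "\<bar>s (j mod int k)\<bar> \<le> (\<Sum>i\<in>{0..<int k}. \<bar>s i\<bar>)"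
      by (intro member_le_sum) auto
    then show ?thesis by (simp add: periodic_seq_mod[OF s])
  qed
  then show ?thesis unfolding bounded_seq_def by blast
qed

lemma periodic_seq_unroll: "periodic_seq k (unroll k c)"
proof -
  have "j + int k - 1 = (j - 1) + int k" for j
    by simp
  then show ?thesis
    unfolding periodic_seq_def unroll_def by (metis mod_add_self2)
qed

lemma unroll_at_rim: "i \<in> {1..k} \<Longrightarrow> unroll k c (int i) = c i"
  using rim_index_eq_iff[of i k "int i"] by (simp add: unroll_def)

lemma unroll_eqI:
  assumes k: "1 \<le> k" and s: "periodic_seq k s" and c: "\<And>i. i \<in> {1..k} \<Longrightarrow> c i = s (int i)"
  shows "unroll k c = s"
proof
  fix j
  let ?i = "nat ((j - 1) mod int k) + 1"
  have i: "?i \<in> {1..k}" by (rule rim_index[OF k])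
  then have "j mod int k = int ?i mod int k"
    using rim_index_eq_iff[OF i, of j] by simp
  then have "s (int ?i) = s j"
    using periodic_seq_mod[OF s] by metis
  then show "unroll k c j = s j"
    unfolding unroll_def using c[OF i] by simp
qed

lemma unroll_inj_on_configs:
  assumes "c \<in> configs {0..k} 0" "d \<in> configs {0..k} 0" "unroll k c = unroll k d"
  shows "c = d"
proof
  fix v
  show "c v = d v"
  proof (cases "v \<in> {1..k}")
    case True
    then show ?thesis using assms(3) unroll_at_rim by metis
  next
    case False
    then show ?thesis using assms(1,2) unfolding configs_def rim_vertices by simp
  qed
qed

text \<open>Adding \<open>int t * B\<close> stays in the class and, as \<open>t\<close> is positive
  and \<open>B\<close> bounds the absolute values, makes all entries nonnegative. The result is then
  a configuration from which a critical one is reachable.\<close>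

lemma critical_representative:
  assumes k: "1 \<le> k" and t: "1 \<le> t" and s: "periodic_seq k s"
  shows "\<exists>c. wheel_critical k q t c \<and> firing_equiv q t (unroll k c) s"
proof -
  obtain B where B: "\<forall>j. \<bar>s j\<bar> \<le> B"
    using periodic_seq_bounded[OF k s] unfolding bounded_seq_def by blast
  then have "0 \<le> B" by (meson abs_ge_zero order_trans)
  then have "B \<le> int t * B" using t by (simp add: mult_le_cancel_right1)
  then have nonneg: "0 \<le> s j + int t * B" for j
    using B[rule_format, of j] by linarith
  define c where "c = (\<lambda>i. if i \<in> {1..k} then s (int i) + int t * B else 0)"
  have "c \<in> configs {0..k} 0"
    unfolding configs_def rim_vertices c_def using nonneg by auto
  then obtain d where d: "wheel_critical k q t d" "(wheel_step k q t)\<^sup>*\<^sup>* c d"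
    using wheel_reaches_critical[OF t] by blast
  have "unroll k c = (\<lambda>j. s j + int t * B)"
    using s by (intro unroll_eqI[OF k]) (auto simp: c_def periodic_seq_def)
  then have "firing_equiv q t (unroll k c) s"
    by (simp add: firing_equiv_add_const)
  with wheel_steps_firing_equiv[OF k d(2)] d(1) show ?thesis
    using firing_equiv_trans by blast
qed

text \<open>The critical representative of the class of \<open>s\<close> is itself recurrent, so
  uniqueness identifies it with \<open>s\<close>. This is the converse half of the burning
  criterion.\<close>

lemma recurrent_seq_critical:
  assumes k: "1 \<le> k" and t: "1 \<le> t" and s: "periodic_seq k s" "recurrent_seq q t s"
  shows "\<exists>c. wheel_critical k q t c \<and> unroll k c = s"
proof -
  obtain c where c: "wheel_critical k q t c" "firing_equiv q t (unroll k c) s"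
    using critical_representative[OF k t s(1)] by blast
  have "unroll k c = s"
    using recurrent_seq_unique[OF t critical_recurrent_seq[OF k t c(1)] s(2) c(2)] .
  with c(1) show ?thesis by blast
qed

text \<open>Makes the definite description in \<open>crit_sum\<close> usable: a critical
  configuration is reachable, and any two reachable ones unroll to equivalent recurrent
  sequences.\<close>

lemma crit_sum_wheel:
  assumes k: "1 \<le> k" and t: "1 \<le> t" and c: "wheel_critical k q t c1" "wheel_critical k q t c2"
  defines "c \<equiv> crit_sum {0..k} (wheel_edges k q t) 0 c1 c2"
  shows "wheel_critical k q t c"
    and "firing_equiv q t (unroll k c) (\<lambda>j. unroll k c1 j + unroll k c2 j)"
proof -
  let ?Q = "\<lambda>d. wheel_critical k q t d \<and> (wheel_step k q t)\<^sup>*\<^sup>* (\<lambda>v. c1 v + c2 v) d"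
  have "(\<lambda>v. c1 v + c2 v) \<in> configs {0..k} 0"
    using c unfolding critical_def configs_def by auto
  then have ex: "\<exists>d. ?Q d"
    by (rule wheel_reaches_critical[OF t])
  have "d = e" if "?Q d" "?Q e" for d e
  proof (rule unroll_inj_on_configs)
    have "firing_equiv q t (unroll k d) (unroll k e)"
      using that wheel_steps_firing_equiv[OF k] firing_equiv_sym firing_equiv_trans by meson
    then show "unroll k d = unroll k e"
      using that critical_recurrent_seq[OF k t] recurrent_seq_unique[OF t] by blast
  qed (use that in \<open>auto simp: critical_def\<close>)
  with ex have "\<exists>!d. ?Q d" by blast
  from theI'[OF this] have Q: "?Q c"
    unfolding c_def crit_sum_def .
  then show "wheel_critical k q t c" by blast
  have "unroll k (\<lambda>v. c1 v + c2 v) = (\<lambda>j. unroll k c1 j + unroll k c2 j)"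
    by (simp add: unroll_def)
  with Q wheel_steps_firing_equiv[OF k]
  show "firing_equiv q t (unroll k c) (\<lambda>j. unroll k c1 j + unroll k c2 j)"
    by metis
qed

section \<open>The limit group\<close>

lemma carrier_wheel_group: "carrier (wheel_group k q t) = {c. wheel_critical k q t c}"
  by (simp add: wheel_group_def critical_group_def mk_monoid_def)

lemma mult_wheel_group:
  "c1 \<otimes>\<^bsub>wheel_group k q t\<^esub> c2 = crit_sum {0..k} (wheel_edges k q t) 0 c1 c2"
  by (simp add: wheel_group_def critical_group_def mk_monoid_def)

text \<open>Recurrence does not mention \<open>k\<close>, so a period may be replaced by a multiple.
  This is how the embeddings between the wheel groups enter.\<close>

lemma carrier_limit_group:
  assumes t: "1 \<le> t"
  shows "carrier (limit_group q t) = {s. recurrent_seq q t s \<and> (\<exists>k\<ge>1. periodic_seq k s)}"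
proof -
  have "(\<exists>k c. s = unroll k c \<and> 1 \<le> k \<and> wheel_critical k q t c) \<longleftrightarrow>
      recurrent_seq q t s \<and> (\<exists>k\<ge>1. periodic_seq k s)" for s
    using recurrent_seq_critical[OF _ t] critical_recurrent_seq[OF _ t] periodic_seq_unroll by metis
  then show ?thesis
    by (simp add: limit_group_def mk_monoid_def carrier_wheel_group)
qed

lemma common_period:
  assumes "\<exists>k\<ge>1. periodic_seq k x" "\<exists>k\<ge>1. periodic_seq k y"
  obtains k where "1 \<le> k" "periodic_seq k x" "periodic_seq k y"
proof -
  obtain k1 k2 where "1 \<le> k1" "periodic_seq k1 x" "1 \<le> k2" "periodic_seq k2 y"
    using assms by blast
  then show ?thesis
    using that[of "k1 * k2"] periodic_seq_mult by (simp add: Suc_le_eq)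
qed

lemma limit_group_unique:
  assumes "1 \<le> t" "x \<in> carrier (limit_group q t)" "y \<in> carrier (limit_group q t)"
    "firing_equiv q t x y"
  shows "x = y"
  using assms(2-) recurrent_seq_unique[OF assms(1), of q x y]
  unfolding carrier_limit_group[OF assms(1)] by blast

lemma limit_group_representative:
  assumes t: "1 \<le> t" and "\<exists>k\<ge>1. periodic_seq k s"
  obtains r where "r \<in> carrier (limit_group q t)" "firing_equiv q t r s"
proof -
  obtain k where k: "1 \<le> k" "periodic_seq k s" using assms(2) by blast
  obtain c where c: "wheel_critical k q t c" "firing_equiv q t (unroll k c) s"
    using critical_representative[OF k(1) t k(2)] by blast
  have "unroll k c \<in> carrier (limit_group q t)"
    unfolding carrier_limit_group[OF t]
    using critical_recurrent_seq[OF k(1) t c(1)] periodic_seq_unroll k(1) by blast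
  then show ?thesis using c(2) by (rule that)
qed

lemma limit_group_mult:
  assumes t: "1 \<le> t"
    and x: "x \<in> carrier (limit_group q t)" and y: "y \<in> carrier (limit_group q t)"
  shows "x \<otimes>\<^bsub>limit_group q t\<^esub> y \<in> carrier (limit_group q t)"
    and "firing_equiv q t (x \<otimes>\<^bsub>limit_group q t\<^esub> y) (\<lambda>j. x j + y j)"
proof -
  let ?Q = "\<lambda>s. \<exists>k\<ge>1. \<exists>c1\<in>carrier (wheel_group k q t). \<exists>c2\<in>carrier (wheel_group k q t).
        x = unroll k c1 \<and> y = unroll k c2 \<and> s = unroll k (c1 \<otimes>\<^bsub>wheel_group k q t\<^esub> c2)"
  have Q: "s \<in> carrier (limit_group q t) \<and> firing_equiv q t s (\<lambda>j. x j + y j)" if s: "?Q s" for s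
  proof -
    obtain k c1 c2 where k: "1 \<le> k" and c: "wheel_critical k q t c1" "wheel_critical k q t c2"
      and eqs: "x = unroll k c1" "y = unroll k c2"
        "s = unroll k (crit_sum {0..k} (wheel_edges k q t) 0 c1 c2)"
      using s unfolding carrier_wheel_group mult_wheel_group by blast
    show ?thesis
      unfolding carrier_limit_group[OF t] eqs
      using crit_sum_wheel[OF k t c] critical_recurrent_seq[OF k t] periodic_seq_unroll k by blast
  qed
  have "\<exists>s. ?Q s"
  proof -
    obtain k where k: "1 \<le> k" "periodic_seq k x" "periodic_seq k y"
      using x y common_period unfolding carrier_limit_group[OF t] by blast
    then obtain c1 c2 where "wheel_critical k q t c1" "unroll k c1 = x"
      "wheel_critical k q t c2" "unroll k c2 = y"
      using x y recurrent_seq_critical[OF k(1) t] unfolding carrier_limit_group[OF t] by blast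
    with k(1) show ?thesis
      unfolding carrier_wheel_group by blast
  qed
  moreover have "s = s'" if "?Q s" "?Q s'" for s s'
  proof (rule limit_group_unique[OF t])
    show "firing_equiv q t s s'"
      using Q[OF that(1)] Q[OF that(2)] firing_equiv_sym firing_equiv_trans by meson
  qed (use Q that in blast)+
  ultimately have "\<exists>!s. ?Q s" by blast
  from theI'[OF this] have "?Q (x \<otimes>\<^bsub>limit_group q t\<^esub> y)"
    by (simp only: limit_group_def mk_monoid_def limit_sum_def monoid.simps)
  from Q[OF this] show "x \<otimes>\<^bsub>limit_group q t\<^esub> y \<in> carrier (limit_group q t)"
    "firing_equiv q t (x \<otimes>\<^bsub>limit_group q t\<^esub> y) (\<lambda>j. x j + y j)" by blast+
qed

text \<open>The working rule for products: it suffices to compare pointwise sums up to firing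
  equivalence.\<close>

lemma limit_group_multI:
  assumes t: "1 \<le> t" and x: "x \<in> carrier (limit_group q t)" and y: "y \<in> carrier (limit_group q t)"
    and z: "z \<in> carrier (limit_group q t)" and "firing_equiv q t (\<lambda>j. x j + y j) z"
  shows "x \<otimes>\<^bsub>limit_group q t\<^esub> y = z"
  using limit_group_unique[OF t limit_group_mult(1)[OF t x y] z]
    firing_equiv_trans[OF limit_group_mult(2)[OF t x y]] assms(5) by blast

lemma periodic_seq_zero: "\<exists>k\<ge>1. periodic_seq k (\<lambda>_. 0)"
  unfolding periodic_seq_def by auto

lemma limit_group_one:
  assumes t: "1 \<le> t"
  shows "\<one>\<^bsub>limit_group q t\<^esub> \<in> carrier (limit_group q t)"
    and "firing_equiv q t \<one>\<^bsub>limit_group q t\<^esub> (\<lambda>_. 0)"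
proof -
  let ?G = "limit_group q t"
  \<comment> \<open>The zero sequence is not recurrent, since the whole line is forbidden for it;
    the neutral element is the recurrent member of its class.\<close>
  obtain e where e: "e \<in> carrier ?G" "firing_equiv q t e (\<lambda>_. 0)"
    using limit_group_representative[OF t periodic_seq_zero] by blast
  have unit: "e \<otimes>\<^bsub>?G\<^esub> x = x \<and> x \<otimes>\<^bsub>?G\<^esub> e = x" if "x \<in> carrier ?G" for x
    using firing_equiv_add[OF e(2) firing_equiv_refl, of x]
      firing_equiv_add[OF firing_equiv_refl e(2), of x] that e(1)
    by (simp add: limit_group_multI[OF t])
  have "\<one>\<^bsub>?G\<^esub> = (THE e. e \<in> carrier ?G \<and> (\<forall>x\<in>carrier ?G. e \<otimes>\<^bsub>?G\<^esub> x = x \<and> x \<otimes>\<^bsub>?G\<^esub> e = x))"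
    by (simp add: limit_group_def mk_monoid_def)
  also have "\<dots> = e"
    using unit e(1) by (intro the_equality) metis+
  finally show "\<one>\<^bsub>?G\<^esub> \<in> carrier ?G" "firing_equiv q t \<one>\<^bsub>?G\<^esub> (\<lambda>_. 0)"
    using e by simp_all
qed

text \<open>Each axiom is inherited from pointwise addition of integer sequences; inverses are
  representatives of pointwise negatives.\<close>

lemma comm_group_limit_group:
  assumes t: "1 \<le> t"
  shows "comm_group (limit_group q t)"
proof (rule comm_groupI)
  let ?G = "limit_group q t"
  note mult = limit_group_mult[OF t] and one = limit_group_one[OF t, of q]
  show "x \<otimes>\<^bsub>?G\<^esub> y \<in> carrier ?G" if "x \<in> carrier ?G" "y \<in> carrier ?G" for x y
    using mult(1)[OF that] .
  show "\<one>\<^bsub>?G\<^esub> \<in> carrier ?G" by (rule one)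
  show "x \<otimes>\<^bsub>?G\<^esub> y \<otimes>\<^bsub>?G\<^esub> z = x \<otimes>\<^bsub>?G\<^esub> (y \<otimes>\<^bsub>?G\<^esub> z)"
    if x: "x \<in> carrier ?G" and y: "y \<in> carrier ?G" and z: "z \<in> carrier ?G" for x y z
  proof (rule limit_group_multI[OF t mult(1)[OF x y] z])
    show "x \<otimes>\<^bsub>?G\<^esub> (y \<otimes>\<^bsub>?G\<^esub> z) \<in> carrier ?G"
      using x y z mult(1) by blast
    have "firing_equiv q t (\<lambda>j. (x \<otimes>\<^bsub>?G\<^esub> y) j + z j) (\<lambda>j. x j + y j + z j)"
      by (rule firing_equiv_add[OF mult(2)[OF x y] firing_equiv_refl])
    moreover have "firing_equiv q t (\<lambda>j. x j + (y \<otimes>\<^bsub>?G\<^esub> z) j) (\<lambda>j. x j + (y j + z j))"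
      by (rule firing_equiv_add[OF firing_equiv_refl mult(2)[OF y z]])
    ultimately show "firing_equiv q t (\<lambda>j. (x \<otimes>\<^bsub>?G\<^esub> y) j + z j) (x \<otimes>\<^bsub>?G\<^esub> (y \<otimes>\<^bsub>?G\<^esub> z))"
      using mult(2)[OF x mult(1)[OF y z]] firing_equiv_sym firing_equiv_trans
      unfolding add.assoc by meson
  qed
  show "x \<otimes>\<^bsub>?G\<^esub> y = y \<otimes>\<^bsub>?G\<^esub> x" if x: "x \<in> carrier ?G" and y: "y \<in> carrier ?G" for x y
    using limit_group_multI[OF t x y mult(1)[OF y x]] firing_equiv_sym[OF mult(2)[OF y x]]
    by (simp add: add.commute)
  show "\<one>\<^bsub>?G\<^esub> \<otimes>\<^bsub>?G\<^esub> x = x" if x: "x \<in> carrier ?G" for x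
    using limit_group_multI[OF t one(1) x x] firing_equiv_add[OF one(2) firing_equiv_refl, of x]
    by simp
  show "\<exists>y\<in>carrier ?G. y \<otimes>\<^bsub>?G\<^esub> x = \<one>\<^bsub>?G\<^esub>" if x: "x \<in> carrier ?G" for x
  proof -
    have "\<exists>k\<ge>1. periodic_seq k (\<lambda>j. - x j)"
      using x by (auto simp: carrier_limit_group[OF t] periodic_seq_def)
    then obtain y where y: "y \<in> carrier ?G" "firing_equiv q t y (\<lambda>j. - x j)"
      using limit_group_representative[OF t] by blast
    have "firing_equiv q t (\<lambda>j. y j + x j) (\<lambda>_. 0)"
      using firing_equiv_add[OF y(2) firing_equiv_refl, of x] by simp
    then have "y \<otimes>\<^bsub>?G\<^esub> x = \<one>\<^bsub>?G\<^esub>"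
      using limit_group_multI[OF t y(1) x one(1)] firing_equiv_sym[OF one(2)] firing_equiv_trans
      by blast
    with y(1) show ?thesis by blast
  qed
qed

lemma limit_group_pow:
  assumes t: "1 \<le> t" and x: "x \<in> carrier (limit_group q t)"
  shows "firing_equiv q t (x [^]\<^bsub>limit_group q t\<^esub> n) (\<lambda>j. int n * x j)"
proof -
  interpret comm_group "limit_group q t" by (rule comm_group_limit_group[OF t])
  show ?thesis
  proof (induction n)
    case 0
    show ?case using limit_group_one(2)[OF t] by simp
  next
    case (Suc n)
    have "firing_equiv q t (\<lambda>j. (x [^]\<^bsub>limit_group q t\<^esub> n) j + x j) (\<lambda>j. int (Suc n) * x j)"
      using firing_equiv_add[OF Suc firing_equiv_refl, of x] by (simp add: algebra_simps)
    then show ?case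
      using limit_group_mult(2)[OF t nat_pow_closed[OF x] x, of n]
      by (simp add: firing_equiv_trans)
  qed
qed

lemma limit_group_inv:
  assumes t: "1 \<le> t" and x: "x \<in> carrier (limit_group q t)"
  shows "firing_equiv q t (inv\<^bsub>limit_group q t\<^esub> x) (\<lambda>j. - x j)"
proof -
  interpret comm_group "limit_group q t" by (rule comm_group_limit_group[OF t])
  let ?y = "inv\<^bsub>limit_group q t\<^esub> x"
  have "firing_equiv q t \<one>\<^bsub>limit_group q t\<^esub> (\<lambda>j. ?y j + x j)"
    using limit_group_mult(2)[OF t inv_closed[OF x] x] x by simp
  then have "firing_equiv q t (\<lambda>j. ?y j + x j) (\<lambda>_. 0)"
    using limit_group_one(2)[OF t] firing_equiv_sym firing_equiv_trans by blast
  from firing_equiv_add[OF this firing_equiv_refl, of "\<lambda>j. - x j"] show ?thesis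
    by simp
qed

section \<open>The shift endomorphism and its quadratic relation\<close>

lemma shift_closed:
  assumes t: "1 \<le> t" and "s \<in> carrier (limit_group q t)"
  shows "shift s \<in> carrier (limit_group q t)"
proof -
  have "j + int k + 1 = (j + 1) + int k" for j k
    by simp
  then have "periodic_seq k s \<Longrightarrow> periodic_seq k (shift s)" for k
    unfolding periodic_seq_def shift_def by metis
  then show ?thesis
    using assms(2) recurrent_seq_shift by (auto simp: carrier_limit_group[OF t])
qed

lemma shift_hom:
  assumes t: "1 \<le> t"
  shows "shift \<in> hom (limit_group q t) (limit_group q t)"
proof (rule homI)
  let ?G = "limit_group q t"
  fix x y
  assume x: "x \<in> carrier ?G" and y: "y \<in> carrier ?G"
  show "shift x \<in> carrier ?G" using shift_closed[OF t x] .
  have "firing_equiv q t (\<lambda>j. shift x j + shift y j) (shift (x \<otimes>\<^bsub>?G\<^esub> y))"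
    using firing_equiv_shift[OF firing_equiv_sym[OF limit_group_mult(2)[OF t x y]]]
    by (simp add: shift_def)
  then show "shift (x \<otimes>\<^bsub>?G\<^esub> y) = shift x \<otimes>\<^bsub>?G\<^esub> shift y"
    using limit_group_multI[OF t shift_closed[OF t x] shift_closed[OF t y]
        shift_closed[OF t limit_group_mult(1)[OF t x y]]] by simp
qed

theorem theorem9:
  fixes q t :: nat
  assumes "1 \<le> t"
  shows "comm_group (limit_group q t) \<and>
         shift \<in> hom (limit_group q t) (limit_group q t) \<and>
         (\<forall>s\<in>carrier (limit_group q t).
            shift (shift s)
              \<otimes>\<^bsub>limit_group q t\<^esub> inv\<^bsub>limit_group q t\<^esub> (shift s [^]\<^bsub>limit_group q t\<^esub> (1 + q + t))
              \<otimes>\<^bsub>limit_group q t\<^esub> (s [^]\<^bsub>limit_group q t\<^esub> q)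
            = \<one>\<^bsub>limit_group q t\<^esub>)"
proof (intro conjI ballI)
  let ?G = "limit_group q t"
  note t = assms
  interpret comm_group ?G by (rule comm_group_limit_group[OF t])
  show "comm_group ?G" by (rule comm_group_limit_group[OF t])
  show "shift \<in> hom ?G ?G" by (rule shift_hom[OF t])
  fix s
  assume s: "s \<in> carrier ?G"
  note s1 = shift_closed[OF t s]
  note s2 = shift_closed[OF t s1]
  define p where "p = shift s [^]\<^bsub>?G\<^esub> (1 + q + t)"
  have p: "p \<in> carrier ?G" unfolding p_def using s1 by (rule nat_pow_closed)
  \<comment> \<open>The equivalence for the power \<open>p\<close> is negated in two additions:
    first the negated multiple of \<open>shift s\<close> is added to both sides, then
    \<open>- p\<close>.\<close>
  have "firing_equiv q t (\<lambda>j. p j + - (int (1 + q + t) * shift s j)) (\<lambda>_. 0)"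
    unfolding p_def using firing_equiv_add[OF limit_group_pow[OF t s1] firing_equiv_refl,
        of "1 + q + t" "\<lambda>j. - (int (1 + q + t) * shift s j)"] by simp
  from firing_equiv_add[OF firing_equiv_sym[OF this] firing_equiv_refl, of "\<lambda>j. - p j"]
  have "firing_equiv q t (\<lambda>j. - p j) (\<lambda>j. - (int (1 + q + t) * shift s j))"
    by simp
  with limit_group_inv[OF t p]
  have invp: "firing_equiv q t (inv\<^bsub>?G\<^esub> p) (\<lambda>j. - (int (1 + q + t) * shift s j))"
    by (rule firing_equiv_trans)
  have a: "shift (shift s) \<otimes>\<^bsub>?G\<^esub> inv\<^bsub>?G\<^esub> p \<in> carrier ?G"
    using s2 p by simp
  have ea: "firing_equiv q t (shift (shift s) \<otimes>\<^bsub>?G\<^esub> inv\<^bsub>?G\<^esub> p)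
      (\<lambda>j. shift (shift s) j + - (int (1 + q + t) * shift s j))"
    using firing_equiv_trans[OF limit_group_mult(2)[OF t s2 inv_closed[OF p]]
        firing_equiv_add[OF firing_equiv_refl invp]] .
  obtain k where "1 \<le> k" "periodic_seq k (shift s)"
    using s1 unfolding carrier_limit_group[OF t] by blast
  \<comment> \<open>The witness is the negative of \<open>shift s\<close>: the pointwise form of the
    quadratic relation is exactly its rim Laplacian.\<close>
  then have "bounded_seq (\<lambda>j. - shift s j)"
    by (intro bounded_seq_uminus periodic_seq_bounded)
  then have "firing_equiv q t
      (\<lambda>j. (shift (shift s) j + - (int (1 + q + t) * shift s j)) + int q * s j) (\<lambda>_. 0)"
    by (rule firing_equivI) (simp add: rim_laplacian_uminus rim_laplacian_def shift_def)
  with firing_equiv_add[OF ea limit_group_pow[OF t s, of q]]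
  have "firing_equiv q t
      (\<lambda>j. (shift (shift s) \<otimes>\<^bsub>?G\<^esub> inv\<^bsub>?G\<^esub> p) j + (s [^]\<^bsub>?G\<^esub> q) j) \<one>\<^bsub>?G\<^esub>"
    using firing_equiv_sym[OF limit_group_one(2)[OF t]] firing_equiv_trans by meson
  from limit_group_multI[OF t a nat_pow_closed[OF s] one_closed this]
  show "shift (shift s) \<otimes>\<^bsub>?G\<^esub> inv\<^bsub>?G\<^esub> (shift s [^]\<^bsub>?G\<^esub> (1 + q + t)) \<otimes>\<^bsub>?G\<^esub> (s [^]\<^bsub>?G\<^esub> q)
      = \<one>\<^bsub>?G\<^esub>"
    unfolding p_def .
qed

end
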